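(* Let $R=\{\beta_0,\beta_1,\dots,\beta_{q-1}\}$ be a finite commutative Frobenius ring with $q$ elements, let $\chi$ be a nontrivial additive character of $R$, and put $Q=\{0,1,\dots,q-1\}$. Let $C\subseteq R^N$ be a linear $P_R$-code over a poset $P$ of size $N$ with $s$ levels of sizes $n_1,\dots,n_s$ (so $N=n_1+\cdots+n_s$), and let $a=\min_j n_j$, $b=\max_j n_j$. Then the relation between the byte poset level weight enumerator of $C$ and that of its dual $C^\perp$ is given by $$B_W\left(C^\perp \mid z_{i:\overline{a}} : \overline{a}\in R^{n_i},\ 1\le i\le s\right)=\frac{1}{|C|}\sum_{u\in C}\ \prod_{m=a}^{b}\ \prod_{S=1}^{s}\ \prod_{(i_1,\dots,i_m)\in Q^m}\left(\sum_{(j_1,\dots,j_m)\in Q^m}\chi\Big(\sum_{k=1}^m \beta_{j_k}\beta_{i_k}\Big)\, z_{S:j_1\dots j_m}\right)^{\mu_{S:i_1\dots i_m}(u)} .$$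
   Context: An additive character of $R$ is a homomorphism $(R,+)\to\mathbb{C}^\times$; it is nontrivial if it is not identically $1$. A finite commutative ring $R$ is Frobenius if its character group $\widehat R=\mathrm{Hom}_{\mathbb Z}(R,\mathbb C^\times)$ is isomorphic to $R$ as an $R$-module. A linear code $C$ is an $R$-submodule of $R^N$. The coordinates of $R^N$ are labelled by the elements of a finite poset $P$ of size $N$, which is partitioned into $s$ levels, the $i$th level having $n_i\ge 1$ elements. Such a $C$ is called a linear $P_R$-code. Each $u\in R^N$ is written in its $s$-level representation $u=(u^1,\dots,u^s)$, with $u^i=(u_{i1},\dots,u_{in_i})\in R^{n_i}$ the part of $u$ in level $i$. The inner product is $\langle u,v\rangle=\sum_{i=1}^s\sum_{j=1}^{n_i}u_{ij}v_{ij}$, and $C^\perp=\{v\in R^N:\langle u,v\rangle=0\text{ for all }u\in C\}$. For $S,k\in\{1,\dots,s\}$ and a tuple $(i_1,\dots,i_m)\in Q^m$ with $a\le m\le b$, set $\eta_{S:i_1\dots i_m}(u^k)=1$ if $S=k$, $m=n_k$ and $u^k=(\beta_{i_1},\dots,\beta_{i_m})$, and $\eta_{S:i_1\dots i_m}(u^k)=0$ otherwise. Put $\mu_{S:i_1\dots i_m}(u)=\sum_{k=1}^s\eta_{S:i_1\dots i_m}(u^k)$. Let $z_{S:i_1\dots i_m}$ ($1\le S\le s$, $a\le m\le b$, $(i_1,\dots,i_m)\in Q^m$) be commuting indeterminates over $\mathbb{C}$; for $\overline{a}=(\beta_{i_1},\dots,\beta_{i_{n_i}})\in R^{n_i}$,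 $z_{i:\overline{a}}$ means $z_{i:i_1\dots i_{n_i}}$. The byte poset level weight enumerator of a linear $P_R$-code $C$ is $$B_W\left(C\mid z_{i:\overline a}:\overline a\in R^{n_i},1\le i\le s\right)=\sum_{u\in C}\prod_{m=a}^{b}\prod_{S=1}^{s}\prod_{(i_1,\dots,i_m)\in Q^m}z_{S:i_1\dots i_m}^{\mu_{S:i_1\dots i_m}(u)}.$$ A zeroth power is $1$, so all factors with $m\neq n_S$ equal $1$. The byte poset level weight enumerator of $C^\perp$ is defined by the same formula with $C^\perp$ in place of $C$ (same levels).
   Formalization: The character χ is assumed to generate the character group of R as an R-module, not merely to be nontrivial; with only nontriviality the identity fails, e.g. for R=Z/4, χ(x)=(-1)^x, N=1, C=R, where the left side is z_0 and the right side is z_0+z_2. *)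

theory Defs
  imports "HOL-Analysis.Analysis" "HOL-Library.Poly_Mapping"
begin

definition additive_character :: "('a::comm_ring_1 \<Rightarrow> complex) \<Rightarrow> bool" where
  "additive_character chi \<longleftrightarrow> (\<forall>x. chi x \<noteq> 0) \<and> (\<forall>x y. chi (x + y) = chi x * chi y)"

definition nontrivial_character :: "('a::comm_ring_1 \<Rightarrow> complex) \<Rightarrow> bool" where
  "nontrivial_character chi \<longleftrightarrow> (\<exists>x. chi x \<noteq> 1)"

text \<open>The character group is an \<open>R\<close>-module under pointwise multiplication and the scalar action
  \<open>(r \<psi>)(t) = \<psi>(r t)\<close>; \<open>\<Phi>\<close> below is a module isomorphism from \<open>R\<close> onto it.\<close>

definition frobenius_ring :: "'a::{finite, comm_ring_1} itself \<Rightarrow> bool" where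
  "frobenius_ring _ \<longleftrightarrow>
     (\<exists>\<Phi> :: 'a \<Rightarrow> 'a \<Rightarrow> complex.
        bij_betw \<Phi> UNIV {\<psi>. additive_character \<psi>} \<and>
        (\<forall>x y. \<Phi> (x + y) = (\<lambda>t. \<Phi> x t * \<Phi> y t)) \<and>
        (\<forall>r x. \<Phi> (r * x) = (\<lambda>t. \<Phi> x (r * t))))"

text \<open>\<open>chi\<close> generates the character group as an \<open>R\<close>-module. Over a Frobenius ring a nontrivial
  character need not have this property, and the MacWilliams identity can then fail: over
  \<open>\<int>/4\<int>\<close> take \<open>chi x = (-1)^x\<close>, a single coordinate and \<open>C = R\<close>. The dual code is zero, so its
  enumerator is the indeterminate of \<open>0\<close>, whereas the transformed enumerator of \<open>C\<close> is the sum of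
  the indeterminates of \<open>0\<close> and \<open>2\<close>.\<close>

definition generating_character :: "('a::comm_ring_1 \<Rightarrow> complex) \<Rightarrow> bool" where
  "generating_character chi \<longleftrightarrow>
     additive_character chi \<and>
     (\<forall>\<psi>. additive_character \<psi> \<longrightarrow> (\<exists>r. \<psi> = (\<lambda>t. chi (r * t))))"

lemma module_vec: "module ((*s) :: 'a::comm_ring_1 \<Rightarrow> 'a ^ 'p \<Rightarrow> 'a ^ 'p)"
  by unfold_locales (simp_all add: vector_add_ldistrib vector_sadd_rdistrib vector_smult_assoc)

text \<open>Coordinates are labelled by the elements of a poset \<open>'p\<close>, and a linear code is a submodule
  of \<open>'a ^ 'p\<close>.\<close>

abbreviation linear_code :: "('a::comm_ring_1 ^ 'p::{finite, order}) set \<Rightarrow> bool" where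
  "linear_code C \<equiv> module.subspace (*s) C"

text \<open>A partition of the poset into \<open>s\<close> nonempty levels: \<open>e i j\<close> is the \<open>j\<close>-th element of the
  \<open>i\<close>-th level, for \<open>1 \<le> i \<le> s\<close> and \<open>1 \<le> j \<le> n i\<close>. It need not be the partition by height.\<close>

definition level_partition ::
    "nat \<Rightarrow> (nat \<Rightarrow> nat) \<Rightarrow> (nat \<Rightarrow> nat \<Rightarrow> 'p::{finite, order}) \<Rightarrow> bool" where
  "level_partition s n e \<longleftrightarrow>
     1 \<le> s \<and> (\<forall>i\<in>{1..s}. 1 \<le> n i) \<and>
     bij_betw (\<lambda>(i, j). e i j) (SIGMA i:{1..s}. {1..n i}) UNIV"

definition level_part ::
    "(nat \<Rightarrow> nat) \<Rightarrow> (nat \<Rightarrow> nat \<Rightarrow> 'p) \<Rightarrow> 'a ^ 'p \<Rightarrow> nat \<Rightarrow> 'a list" where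
  "level_part n e u k = map (\<lambda>j. u $ e k j) [1..<Suc (n k)]"

definition level_inner ::
    "nat \<Rightarrow> (nat \<Rightarrow> nat) \<Rightarrow> (nat \<Rightarrow> nat \<Rightarrow> 'p) \<Rightarrow> 'a::comm_ring_1 ^ 'p \<Rightarrow> 'a ^ 'p \<Rightarrow> 'a" where
  "level_inner s n e u v = (\<Sum>i=1..s. \<Sum>j=1..n i. u $ e i j * v $ e i j)"

definition dual_code ::
    "nat \<Rightarrow> (nat \<Rightarrow> nat) \<Rightarrow> (nat \<Rightarrow> nat \<Rightarrow> 'p) \<Rightarrow> ('a::comm_ring_1 ^ 'p) set \<Rightarrow> ('a ^ 'p) set" where
  "dual_code s n e C = {v. \<forall>u\<in>C. level_inner s n e u v = 0}"

text \<open>\<open>Q\<^sup>m\<close> for \<open>Q = {0, \<dots>, q - 1}\<close>; the \<open>k\<close>-th entry of a tuple \<open>is\<close> is \<open>is ! (k - 1)\<close>.\<close>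

definition index_tuples :: "nat \<Rightarrow> nat \<Rightarrow> nat list set" where
  "index_tuples q m = {is. length is = m \<and> set is \<subseteq> {..<q}}"

definition level_eta ::
    "(nat \<Rightarrow> 'a) \<Rightarrow> (nat \<Rightarrow> nat) \<Rightarrow> nat \<Rightarrow> nat list \<Rightarrow> nat \<Rightarrow> 'a list \<Rightarrow> nat" where
  "level_eta \<beta> n S is k w = (if S = k \<and> length is = n k \<and> w = map \<beta> is then 1 else 0)"

definition level_mu ::
    "(nat \<Rightarrow> 'a) \<Rightarrow> nat \<Rightarrow> (nat \<Rightarrow> nat) \<Rightarrow> (nat \<Rightarrow> nat \<Rightarrow> 'p) \<Rightarrow>
     nat \<Rightarrow> nat list \<Rightarrow> 'a ^ 'p \<Rightarrow> nat" where
  "level_mu \<beta> s n e S is u = (\<Sum>k=1..s. level_eta \<beta> n S is k (level_part n e u k))"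

text \<open>Complex polynomials in the indeterminates \<open>z\<^bsub>S:is\<^esub>\<close>, as finitely supported maps from monomials
  to coefficients; the exponent of an indeterminate in a monomial is again a finitely supported
  map.\<close>

type_synonym enum_poly = "((nat \<times> nat list) \<Rightarrow>\<^sub>0 nat) \<Rightarrow>\<^sub>0 complex"

definition const_poly :: "complex \<Rightarrow> enum_poly" where
  "const_poly c = Poly_Mapping.single 0 c"

definition indet :: "nat \<Rightarrow> nat list \<Rightarrow> enum_poly" where
  "indet S is = Poly_Mapping.single (Poly_Mapping.single (S, is) 1) 1"

definition byte_weight_enumerator ::
    "(nat \<Rightarrow> 'a) \<Rightarrow> nat \<Rightarrow> (nat \<Rightarrow> nat) \<Rightarrow> (nat \<Rightarrow> nat \<Rightarrow> 'p) \<Rightarrow>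
     ('a::{finite, comm_ring_1} ^ 'p::finite) set \<Rightarrow> enum_poly" where
  "byte_weight_enumerator \<beta> s n e C =
     (\<Sum>u\<in>C. \<Prod>m=Min (n ` {1..s})..Max (n ` {1..s}). \<Prod>S=1..s. \<Prod>is\<in>index_tuples CARD('a) m.
        indet S is ^ level_mu \<beta> s n e S is u)"

end

theory Submission
  imports Defs
begin

text \<open>Write \<open>\<langle>u, v\<rangle>\<close> for \<open>level_inner\<close>. Expanding the product over the levels turns the right-hand
  side into \<open>1 / |C|\<close> times the sum over all words \<open>v\<close> of \<open>\<Sum>u\<in>C. chi \<langle>u, v\<rangle>\<close> times the monomial of
  \<open>v\<close>, so it suffices that this character sum is \<open>|C|\<close> on the dual code and zero elsewhere. If
  \<open>\<langle>u, v\<rangle> = x \<noteq> 0\<close> for some \<open>u\<in>C\<close>, then \<open>chi\<close> is nontrivial on the ideal generated by \<open>x\<close>: the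
  Frobenius property says that there are as many characters as ring elements, so that the surjection
  \<open>r \<mapsto> chi (r \<cdot>)\<close> onto the characters is injective.\<close>

section \<open>Additive characters and generating characters\<close>

lemma additive_character_zero:
  assumes "additive_character chi"
  shows "chi 0 = 1"
proof -
  have "chi 0 = chi 0 * chi 0" "chi 0 \<noteq> 0"
    using assms unfolding additive_character_def by (metis add_0, blast)
  then show ?thesis by simp
qed

lemma additive_character_sum:
  assumes "additive_character chi"
  shows "chi (\<Sum>x\<in>A. f x) = (\<Prod>x\<in>A. chi (f x))"
proof (induction A rule: infinite_finite_induct)
  case (insert x A)
  then show ?case using assms by (simp add: additive_character_def)
qed (simp_all add: additive_character_zero[OF assms])

lemma generating_character_inj:
  fixes chi :: "'a::{finite, comm_ring_1} \<Rightarrow> complex"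
  assumes frob: "frobenius_ring TYPE('a)" and gen: "generating_character chi"
  shows "inj (\<lambda>r t. chi (r * t))"
proof -
  obtain \<Phi> :: "'a \<Rightarrow> 'a \<Rightarrow> complex" where \<Phi>: "bij_betw \<Phi> UNIV {\<psi>. additive_character \<psi>}"
    using frob unfolding frobenius_ring_def by blast
  have "range (\<lambda>r t. chi (r * t)) = {\<psi>. additive_character \<psi>}"
    using gen unfolding generating_character_def additive_character_def
    by (auto simp: distrib_left image_iff)
  then have "card (range (\<lambda>r t. chi (r * t))) = CARD('a)"
    using bij_betw_same_card[OF \<Phi>] by simp
  then show ?thesis by (intro eq_card_imp_inj_on) simp_all
qed

lemma generating_character_nontrivial_on_ideal:
  fixes chi :: "'a::{finite, comm_ring_1} \<Rightarrow> complex"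
  assumes "frobenius_ring TYPE('a)" and gen: "generating_character chi" and "x \<noteq> 0"
  obtains r where "chi (r * x) \<noteq> 1"
proof -
  \<comment> \<open>Injectivity separates the characters attached to \<open>x\<close> and
    \<open>0\<close>; the latter is constantly \<open>1\<close>.\<close>
  have "(\<lambda>t. chi (x * t)) \<noteq> (\<lambda>t. chi (0 * t))"
    using generating_character_inj[OF assms(1,2)] \<open>x \<noteq> 0\<close> by (meson injD)
  moreover have "chi 0 = 1"
    using gen by (simp add: additive_character_zero generating_character_def)
  ultimately show ?thesis using that by (auto simp: fun_eq_iff mult.commute)
qed

section \<open>Character sums over a linear code\<close>

lemma level_inner_add:
  "level_inner s n e (u + w) v = level_inner s n e u v + level_inner s n e w v"
  by (simp add: level_inner_def sum.distrib distrib_right)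

lemma level_inner_scale:
  "level_inner s n e (r *s u) v = r * level_inner s n e u v"
  by (simp add: level_inner_def sum_distrib_left mult.assoc)

lemma level_inner_commute:
  "level_inner s n e u v = level_inner s n e v u"
  by (simp add: level_inner_def mult.commute)

text \<open>On the dual code every summand is \<open>chi 0 = 1\<close>. Off it, translating
  \<open>C\<close> by a codeword \<open>w\<close> with
  \<open>chi \<langle>w, v\<rangle> \<noteq> 1\<close> multiplies the sum by that value without
  changing it, so the sum vanishes.\<close>

lemma sum_character_level_inner:
  fixes chi :: "'a::{finite, comm_ring_1} \<Rightarrow> complex"
    and C :: "('a ^ 'p::{finite, order}) set"
  assumes frob: "frobenius_ring TYPE('a)" and gen: "generating_character chi"
    and C: "linear_code C"
  shows "(\<Sum>u\<in>C. chi (level_inner s n e u v)) =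
    (if v \<in> dual_code s n e C then of_nat (card C) else 0)"
proof (cases "v \<in> dual_code s n e C")
  case True
  then show ?thesis
    using gen by (simp add: dual_code_def generating_character_def additive_character_zero)
next
  case False
  interpret module "(*s) :: 'a \<Rightarrow> ('a, 'p) vec \<Rightarrow> ('a, 'p) vec" by (rule module_vec)
  have char: "additive_character chi" using gen by (simp add: generating_character_def)
  obtain u where u: "u \<in> C" "level_inner s n e u v \<noteq> 0"
    using False by (auto simp: dual_code_def)
  obtain r where r: "chi (r * level_inner s n e u v) \<noteq> 1"
    using generating_character_nontrivial_on_ideal[OF frob gen u(2)] .
  \<comment> \<open>\<open>chi\<close> may be \<open>1\<close> at
    \<open>\<langle>u, v\<rangle>\<close> itself, so \<open>u\<close> is rescaled within the
    code.\<close>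
  define w where "w = r *s u"
  have w: "w \<in> C" "chi (level_inner s n e w v) \<noteq> 1"
    using u r C by (simp_all add: w_def level_inner_scale subspace_scale)
  let ?T = "\<Sum>u\<in>C. chi (level_inner s n e u v)"
  have "bij_betw ((+) w) C C"
    by (rule bij_betw_byWitness[where f' = "\<lambda>x. x - w"])
      (use C w in \<open>auto intro: subspace_add subspace_diff\<close>)
  then have "?T = (\<Sum>u\<in>C. chi (level_inner s n e (w + u) v))"
    by (rule sum.reindex_bij_betw[symmetric])
  also have "\<dots> = chi (level_inner s n e w v) * ?T"
    using char by (simp add: level_inner_add additive_character_def sum_distrib_left)
  finally show ?thesis using w(2) False by simp
qed

section \<open>Constant polynomials\<close>

lemma const_poly_mult: "const_poly (x * y) = const_poly x * const_poly y"
  by (simp add: const_poly_def mult_single)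

lemma const_poly_0: "const_poly 0 = 0" and const_poly_1: "const_poly 1 = 1"
  by (simp_all add: const_poly_def)

lemma const_poly_sum: "const_poly (\<Sum>x\<in>A. f x) = (\<Sum>x\<in>A. const_poly (f x))"
  by (induction A rule: infinite_finite_induct) (simp_all add: const_poly_def single_add)

lemma const_poly_prod: "const_poly (\<Prod>x\<in>A. f x) = (\<Prod>x\<in>A. const_poly (f x))"
  by (induction A rule: infinite_finite_induct) (simp_all add: const_poly_1 const_poly_mult)

section \<open>Words as families of index tuples\<close>

lemma finite_index_tuples: "finite (index_tuples q m)"
  using finite_lists_length_eq[of "{..<q}" m]
  by (simp add: index_tuples_def conj_commute)

text \<open>This is the tuple at which \<open>level_mu\<close> takes the value \<open>1\<close> for
  level \<open>S\<close>.\<close>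

definition level_index ::
    "(nat \<Rightarrow> 'a) \<Rightarrow> (nat \<Rightarrow> nat) \<Rightarrow> (nat \<Rightarrow> nat \<Rightarrow> 'p) \<Rightarrow> 'a::finite ^ 'p \<Rightarrow> nat \<Rightarrow> nat list" where
  "level_index \<beta> n e u S = map (inv_into {..<CARD('a)} \<beta>) (level_part n e u S)"

context
  fixes \<beta> :: "nat \<Rightarrow> 'a::{finite, comm_ring_1}"
  assumes \<beta>: "bij_betw \<beta> {..<CARD('a)} UNIV"
begin

lemma inv_\<beta>: "\<beta> (inv_into {..<CARD('a)} \<beta> x) = x" "inv_into {..<CARD('a)} \<beta> x < CARD('a)"
proof -
  have "x \<in> \<beta> ` {..<CARD('a)}" using \<beta> by (simp add: bij_betw_def)
  then show "\<beta> (inv_into {..<CARD('a)} \<beta> x) = x" "inv_into {..<CARD('a)} \<beta> x < CARD('a)"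
    using f_inv_into_f[of x \<beta>] inv_into_into[of x \<beta> "{..<CARD('a)}"]
    by simp_all
qed

lemma length_level_index: "length (level_index \<beta> n e u S) = n S"
  by (simp add: level_index_def level_part_def)

lemma level_index_in: "level_index \<beta> n e u S \<in> index_tuples CARD('a) (n S)"
  by (auto simp: index_tuples_def length_level_index) (auto simp: level_index_def inv_\<beta>(2))

text \<open>List entries are counted from 0, positions in a level from 1.\<close>

lemma \<beta>_level_index_nth: "k < n S \<Longrightarrow> \<beta> (level_index \<beta> n e u S ! k) = u $ e S (Suc k)"
  by (simp add: level_index_def level_part_def inv_\<beta> nth_append del: upt_Suc)

text \<open>Uniqueness of the tuple comes from injectivity of \<open>\<beta>\<close> on indices
  below \<open>CARD('a)\<close>.\<close>

lemma level_part_eq_iff: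
  assumes "xs \<in> index_tuples CARD('a) m"
  shows "level_part n e u S = map \<beta> xs \<longleftrightarrow> xs = level_index \<beta> n e u S"
proof
  assume "level_part n e u S = map \<beta> xs"
  then have "level_index \<beta> n e u S = map (inv_into {..<CARD('a)} \<beta>) (map \<beta> xs)"
    by (simp add: level_index_def)
  also have "\<dots> = map id xs"
    unfolding map_map
  proof (rule map_cong)
    fix x assume "x \<in> set xs"
    then show "(inv_into {..<CARD('a)} \<beta> \<circ> \<beta>) x = id x"
      using assms \<beta> by (auto simp: index_tuples_def bij_betw_def)
  qed simp
  finally show "xs = level_index \<beta> n e u S" by simp
next
  assume "xs = level_index \<beta> n e u S"
  then show "level_part n e u S = map \<beta> xs"
    by (simp add: level_index_def comp_def inv_\<beta>)
qed

lemma level_mu_eq: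
  assumes "xs \<in> index_tuples CARD('a) m" "S \<in> {1..s}"
  shows "level_mu \<beta> s n e S xs u = (if xs = level_index \<beta> n e u S then 1 else 0)"
proof -
  have "level_mu \<beta> s n e S xs u =
      (\<Sum>k=1..s. if k = S then (if xs = level_index \<beta> n e u S then 1 else 0) else 0)"
    unfolding level_mu_def level_eta_def
    using level_part_eq_iff[OF assms(1), of n e u]
    by (intro sum.cong refl) (auto simp: length_level_index)
  then show ?thesis using assms(2) by simp
qed

text \<open>The exponents are 0 or 1, so each level keeps a single factor. With \<open>f\<close>
  general, this serves both the enumerator and its transform.\<close>

lemma prod_level_mu:
  fixes f :: "nat \<Rightarrow> nat \<Rightarrow> nat list \<Rightarrow> 'b::comm_semiring_1"
  shows "(\<Prod>m=Min (n ` {1..s})..Max (n ` {1..s}). \<Prod>S=1..s. \<Prod>xs\<in>index_tuples CARD('a) m.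
      f m S xs ^ level_mu \<beta> s n e S xs u) = (\<Prod>S=1..s. f (n S) S (level_index \<beta> n e u S))"
    (is "(\<Prod>m\<in>?M. _) = _")
proof -
  have inner: "(\<Prod>xs\<in>index_tuples CARD('a) m. f m S xs ^ level_mu \<beta> s n e S xs u) =
      (if m = n S then f m S (level_index \<beta> n e u S) else 1)"
    if "S \<in> {1..s}" for S m
  proof -
    have "(\<Prod>xs\<in>index_tuples CARD('a) m. f m S xs ^ level_mu \<beta> s n e S xs u) =
        (\<Prod>xs\<in>index_tuples CARD('a) m. if xs = level_index \<beta> n e u S then f m S xs else 1)"
      using that by (intro prod.cong refl) (auto simp: level_mu_eq)
    also have "\<dots> = (if level_index \<beta> n e u S \<in> index_tuples CARD('a) m
        then f m S (level_index \<beta> n e u S) else 1)"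
      by (simp add: finite_index_tuples)
    also have "level_index \<beta> n e u S \<in> index_tuples CARD('a) m \<longleftrightarrow> m = n S"
      using level_index_in[of n e u S] by (auto simp: index_tuples_def)
    finally show ?thesis .
  qed
  \<comment> \<open>The range from minimum to maximum contains every level size, so no level is
    lost.\<close>
  have M: "n S \<in> ?M" if "S \<in> {1..s}" for S
    using that by auto
  show ?thesis
    \<comment> \<open>With the level outermost, only \<open>m = n S\<close> can contribute a factor
      other than 1.\<close>
    by (rule trans[OF prod.swap], intro prod.cong refl)
      (simp add: inner M del: atLeastAtMost_iff One_nat_def)
qed

text \<open>The levels partition the coordinates, so a word amounts to a free choice of one tuple
  per level. \<open>restrict\<close> makes the family extensional, as \<open>PiE\<close>
  demands.\<close>

lemma bij_level_index:
  fixes e :: "nat \<Rightarrow> nat \<Rightarrow> 'p::{finite, order}"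
  assumes "level_partition s n e"
  shows "bij_betw (\<lambda>v. restrict (level_index \<beta> n e v) {1..s}) UNIV
    (\<Pi>\<^sub>E S\<in>{1..s}. index_tuples CARD('a) (n S))"
proof -
  let ?D = "SIGMA i:{1..s}. {1..n i}" and ?e = "\<lambda>(i, j). e i j"
  have bij: "bij_betw ?e ?D UNIV"
    using assms by (simp add: level_partition_def)
  have ex: "\<exists>i j. i \<in> {1..s} \<and> j < n i \<and> p = e i (Suc j)" for p
  proof -
    have "p \<in> ?e ` ?D"
      using bij_betw_imp_surj_on[OF bij] by blast
    then obtain i j where "(i, j) \<in> ?D" "p = e i j"
      by auto
    then show ?thesis by (intro exI[of _ i] exI[of _ "j - 1"]) auto
  qed
  show ?thesis
  proof (rule bij_betwI')
    fix v w :: "'a ^ 'p::{finite, order}"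
    show "(restrict (level_index \<beta> n e v) {1..s} = restrict (level_index \<beta> n e w) {1..s}) =
        (v = w)"
    proof
      assume eq: "restrict (level_index \<beta> n e v) {1..s} = restrict (level_index \<beta> n e w) {1..s}"
      show "v = w"
      proof (rule vec_eq_iff[THEN iffD2, rule_format])
        fix p
        obtain i j where ij: "i \<in> {1..s}" "j < n i" "p = e i (Suc j)" using ex by blast
        have "level_index \<beta> n e v i = level_index \<beta> n e w i"
          using fun_cong[OF eq, of i] ij(1) by simp
        then show "v $ p = w $ p" using \<beta>_level_index_nth ij by metis
      qed
    qed simp
  next
    fix v :: "'a ^ 'p::{finite, order}"
    show "restrict (level_index \<beta> n e v) {1..s} \<in> (\<Pi>\<^sub>E S\<in>{1..s}. index_tuples CARD('a) (n S))"
      using level_index_in by auto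
  next
    fix J assume J: "J \<in> (\<Pi>\<^sub>E S\<in>{1..s}. index_tuples CARD('a) (n S))"
    \<comment> \<open>The preimage of \<open>J\<close>: coordinate \<open>p\<close> is located as
      the \<open>j\<close>-th element of level \<open>i\<close> and receives the ring element
      indexed by entry \<open>j - 1\<close> of \<open>J i\<close>.\<close>
    define v :: "'a ^ 'p::{finite, order}" where
      "v = (\<chi> p. case inv_into ?D ?e p of (i, j) \<Rightarrow> \<beta> (J i ! (j - 1)))"
    have v: "v $ e i (Suc j) = \<beta> (J i ! j)" if "i \<in> {1..s}" "j < n i" for i j
    proof -
      have "inv_into ?D ?e (?e (i, Suc j)) = (i, Suc j)"
        by (rule inv_into_f_f) (use bij that in \<open>auto simp: bij_betw_def\<close>)
      then show ?thesis by (simp add: v_def)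
    qed
    have "level_index \<beta> n e v S = J S" if S: "S \<in> {1..s}" for S
    proof -
      have JS: "J S \<in> index_tuples CARD('a) (n S)" using J S by (rule PiE_mem)
      then have "length (J S) = n S" by (simp add: index_tuples_def)
      then have "level_part n e v S = map \<beta> (J S)"
        using v[OF S] by (intro nth_equalityI) (simp_all add: level_part_def del: upt_Suc)
      then show ?thesis using level_part_eq_iff[OF JS, of n e v] by simp
    qed
    then have "restrict (level_index \<beta> n e v) {1..s} = restrict J {1..s}"
      by (rule restrict_ext)
    also have "\<dots> = J"
      using J by (rule PiE_restrict)
    finally have "J = restrict (level_index \<beta> n e v) {1..s}" ..
    then show "\<exists>v\<in>UNIV. J = restrict (level_index \<beta> n e v) {1..s}" by blast
  qed
qed

text \<open>Distributivity gives a sum over all families of tuples, which the bijection turns into a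
  sum over words.\<close>

lemma prod_sum_index_tuples:
  fixes f :: "nat \<Rightarrow> nat list \<Rightarrow> 'b::comm_semiring_1"
    and e :: "nat \<Rightarrow> nat \<Rightarrow> 'p::{finite, order}"
  assumes "level_partition s n e"
  shows "(\<Prod>S=1..s. \<Sum>js\<in>index_tuples CARD('a) (n S). f S js) =
    (\<Sum>v\<in>UNIV. \<Prod>S=1..s. f S (level_index \<beta> n e v S))"
proof -
  have "(\<Prod>S=1..s. \<Sum>js\<in>index_tuples CARD('a) (n S). f S js) =
      (\<Sum>J\<in>(\<Pi>\<^sub>E S\<in>{1..s}. index_tuples CARD('a) (n S)). \<Prod>S=1..s. f S (J S))"
    by (rule prod_sum_PiE) (simp_all add: finite_index_tuples)
  also have "\<dots> = (\<Sum>v\<in>UNIV. \<Prod>S=1..s. f S (restrict (level_index \<beta> n e v) {1..s} S))"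
    by (rule sum.reindex_bij_betw[OF bij_level_index[OF assms], symmetric])
  finally show ?thesis by simp
qed

lemma prod_character_level_index:
  assumes "additive_character chi"
  shows "(\<Prod>S=1..s. chi (\<Sum>k<n S. \<beta> (level_index \<beta> n e v S ! k) * \<beta> (level_index \<beta> n e u S ! k))) =
    chi (level_inner s n e v u)"
  unfolding level_inner_def additive_character_sum[OF assms, symmetric]
  by (simp add: \<beta>_level_index_nth sum.atLeast1_atMost_eq)

end

section \<open>The MacWilliams identity\<close>

theorem theorem3p1:
  fixes \<beta> :: "nat \<Rightarrow> 'a::{finite, comm_ring_1}"
    and chi :: "'a \<Rightarrow> complex"
    and s :: nat
    and n :: "nat \<Rightarrow> nat"
    and e :: "nat \<Rightarrow> nat \<Rightarrow> 'p::{finite, order}"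
    and C :: "('a ^ 'p::{finite, order}) set"
  assumes "frobenius_ring TYPE('a)"
    and "bij_betw \<beta> {..<CARD('a)} UNIV"
    and "additive_character chi"
    and "nontrivial_character chi"
    and "generating_character chi"
    and "level_partition s n e"
    and "linear_code C"
  shows "byte_weight_enumerator \<beta> s n e (dual_code s n e C) =
    const_poly (1 / of_nat (card C)) *
    (\<Sum>u\<in>C. \<Prod>m=Min (n ` {1..s})..Max (n ` {1..s}). \<Prod>S=1..s. \<Prod>is\<in>index_tuples CARD('a) m.
       (\<Sum>js\<in>index_tuples CARD('a) m.
          const_poly (chi (\<Sum>k<m. \<beta> (js ! k) * \<beta> (is ! k))) * indet S js)
       ^ level_mu \<beta> s n e S is u)"
proof -
  let ?mon = "\<lambda>v. \<Prod>S=1..s. indet S (level_index \<beta> n e v S)"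
  \<comment> \<open>The zero word lies in \<open>C\<close>, which makes the final division
    legitimate.\<close>
  have card: "card C \<noteq> 0"
    using module.subspace_0[OF module_vec assms(7)] by auto
  have "(\<Sum>u\<in>C. \<Prod>m=Min (n ` {1..s})..Max (n ` {1..s}). \<Prod>S=1..s. \<Prod>is\<in>index_tuples CARD('a) m.
       (\<Sum>js\<in>index_tuples CARD('a) m.
          const_poly (chi (\<Sum>k<m. \<beta> (js ! k) * \<beta> (is ! k))) * indet S js)
       ^ level_mu \<beta> s n e S is u) =
    (\<Sum>u\<in>C. \<Prod>S=1..s. \<Sum>js\<in>index_tuples CARD('a) (n S).
       const_poly (chi (\<Sum>k<n S. \<beta> (js ! k) * \<beta> (level_index \<beta> n e u S ! k))) * indet S js)"
    by (simp only: prod_level_mu[OF assms(2)])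
  \<comment> \<open>The coefficients collected over the levels multiply to a single character value,
    since \<open>chi\<close> turns sums into products.\<close>
  also have "\<dots> = (\<Sum>u\<in>C. \<Sum>v\<in>UNIV. const_poly (chi (level_inner s n e u v)) * ?mon v)"
    by (simp add: prod_sum_index_tuples[OF assms(2,6)] prod.distrib const_poly_prod[symmetric]
        prod_character_level_index[OF assms(2,3)] level_inner_commute del: One_nat_def)
  also have "\<dots> = (\<Sum>v\<in>UNIV. const_poly (\<Sum>u\<in>C. chi (level_inner s n e u v)) * ?mon v)"
    by (subst sum.swap) (simp add: const_poly_sum sum_distrib_right)
  also have "\<dots> = (\<Sum>v\<in>UNIV. if v \<in> dual_code s n e C
      then const_poly (of_nat (card C)) * ?mon v else 0)"
    by (intro sum.cong refl) (simp add: sum_character_level_inner[OF assms(1,5,7)] const_poly_0)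
  also have "\<dots> = const_poly (of_nat (card C)) * (\<Sum>v\<in>dual_code s n e C. ?mon v)"
    by (simp add: sum.If_cases sum_distrib_left)
  \<comment> \<open>The same collapse of exponents, now with \<open>f m S is = indet S is\<close>,
    identifies \<open>?mon v\<close> with the enumerator's summand.\<close>
  also have "(\<Sum>v\<in>dual_code s n e C. ?mon v) = byte_weight_enumerator \<beta> s n e (dual_code s n e C)"
    by (simp add: byte_weight_enumerator_def prod_level_mu[OF assms(2)] del: One_nat_def)
  finally show ?thesis
    using card by (simp add: mult.assoc[symmetric] const_poly_mult[symmetric] const_poly_1)
qed

end
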